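(* Let $R$ be a finite commutative von Neumann regular ring and $R^*=R\setminus\{0_R\}$. Let $G=\Gamma'_{Reg}(R\times\mathbb{F}_2)$, $A=\{(a,1_{\mathbb{F}_2})\mid a\in R,\ a^3=a\}$, and $J=\{(u,0_{\mathbb{F}_2})\mid u\in R^*\}$. For any field $F$ with $|F|=n=p^k$, where $p$ is a prime number and $k$ is a positive integer, $$\Gamma'_{Reg}(R\times F)\cong\begin{cases}\bigsqcup\big(G,\underbrace{AmB_A(G\mid J),\dots,AmB_A(G\mid J)}_{\frac{n-2}{2}}\ \big|\ J\big), & \text{if } p=2,\\[2mm] \bigsqcup\big(G,G,\underbrace{AmB_A(G\mid J),\dots,AmB_A(G\mid J)}_{\frac{n-3}{2}}\ \big|\ J\big), & \text{otherwise.}\end{cases}$$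
   Context: All rings have an identity. A ring $S$ is von Neumann regular if for every $x\in S$ there is $y\in S$ with $xyx=x$. For such $S$, $\Gamma'_{Reg}(S)$ is the simple graph with vertex set $S\setminus\{0_S\}$ in which two distinct vertices $a,b$ are adjacent if and only if $aba=a$ or $bab=b$. For a graph $G$ and $J\subseteq V(G)$, $G-J$ is the graph obtained by deleting the vertices in $J$, and $\langle J\rangle_G$ is the induced subgraph on $J$. The canonical double cover $B(G)$ has vertex set $V(G)\times\mathbb{Z}_2$ and edge set $\{(x,0)(y,1)\mid xy\in E(G)\}$ (so each edge $xy$ of $G$ gives the two edges $(x,0)(y,1)$ and $(y,0)(x,1)$). Amalgamation canonical double cover: for $J\subseteq V(G)$ and $A\subseteq V(G-J)$, $AmB_A(G\mid J)$ is the graph with vertex set $V(B(G-J))\cup J$ (disjoint union) and edge set $$E(B(G-J))\cup\{(v,0)(v,1)\mid v\in A\}\cup E(\langle J\rangle_G)\cup\{u(v,0),\,u(v,1)\mid u\in J,\ v\in V(G-J),\ uv\in E(G)\}.$$ Subgraph amalgamation: let $\{G_i\mid i\in I\}$ be a family of graphs and $J$ a set with $J\subseteq V(G_i)$ for all $i$, $V(G_i)\cap V(G_j)=J$ for all $i\neq j$, and all induced subgraphs $\langle J\rangle_{G_i}$ equal. Then $\bigsqcup(G_i\mid J)$ is the graph with vertex set $\bigcup_{i}(V(G_i)\setminus J)\cup J$ and edge set $\bigcup_i (E(G_i)\setminus E(J))\cup E(J)$, where $E(J)$ is the edge set of the common induced subgraph on $J$. When the listed graphs are repeated or overlap outside $J$,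 they are replaced by isomorphic copies, with $J$ kept fixed pointwise, that are pairwise disjoint outside $J$. *)

theory Defs
  imports "HOL-Algebra.Chinese_Remainder" "HOL-Number_Theory.Residues" "HOL-Library.Z2"
begin

section \<open>Simple graphs\<close>

text \<open>Edges are unordered pairs; the record itself does not enforce simplicity, which is
  proved below for the graphs constructed here.\<close>

record 'v sgraph =
  verts :: "'v set"
  edges :: "'v set set"

definition simple_graph :: "'v sgraph \<Rightarrow> bool" where
  "simple_graph G \<longleftrightarrow> (\<forall>e \<in> edges G. \<exists>u \<in> verts G. \<exists>v \<in> verts G. u \<noteq> v \<and> e = {u, v})"

definition graph_iso :: "'v sgraph \<Rightarrow> 'w sgraph \<Rightarrow> bool" where
  "graph_iso G H \<longleftrightarrow> (\<exists>f. bij_betw f (verts G) (verts H) \<and>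
     (\<forall>u \<in> verts G. \<forall>v \<in> verts G. {u, v} \<in> edges G \<longleftrightarrow> {f u, f v} \<in> edges H))"

definition map_graph :: "('v \<Rightarrow> 'w) \<Rightarrow> 'v sgraph \<Rightarrow> 'w sgraph" where
  "map_graph f G = \<lparr>verts = f ` verts G, edges = (\<lambda>e. f ` e) ` edges G\<rparr>"

definition induced :: "'v sgraph \<Rightarrow> 'v set \<Rightarrow> 'v sgraph" where
  "induced G J = \<lparr>verts = J, edges = {e \<in> edges G. e \<subseteq> J}\<rparr>"

definition delete_verts :: "'v sgraph \<Rightarrow> 'v set \<Rightarrow> 'v sgraph" where
  "delete_verts G J = induced G (verts G - J)"

definition double_cover :: "'v sgraph \<Rightarrow> ('v \<times> bit) sgraph" where
  "double_cover G =
     \<lparr>verts = verts G \<times> UNIV,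
      edges = {{(x, 0), (y, 1)} | x y. {x, y} \<in> edges G}\<rparr>"

text \<open>The disjoint union of \<open>J\<close> and the vertex set of the double cover of \<open>G - J\<close> is taken in a
  sum type, so the copy of \<open>J\<close> inside \<open>AmB A G J\<close> is \<open>Inl ` J\<close>.  It is meant for
  \<open>J \<subseteq> verts G\<close> and \<open>A \<subseteq> verts (delete_verts G J)\<close>.\<close>

definition AmB :: "'v set \<Rightarrow> 'v sgraph \<Rightarrow> 'v set \<Rightarrow> ('v + 'v \<times> bit) sgraph" where
  "AmB A G J =
     \<lparr>verts = Inr ` verts (double_cover (delete_verts G J)) \<union> Inl ` J,
      edges = (\<lambda>e. Inr ` e) ` edges (double_cover (delete_verts G J))
            \<union> {{Inr (v, 0), Inr (v, 1)} | v. v \<in> A}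
            \<union> (\<lambda>e. Inl ` e) ` edges (induced G J)
            \<union> {{Inl u, Inr (v, i)} | u v i.
                 u \<in> J \<and> v \<in> verts (delete_verts G J) \<and> {u, v} \<in> edges G}\<rparr>"


section \<open>Subgraph amalgamation\<close>

definition amalgamable :: "'i set \<Rightarrow> ('i \<Rightarrow> 'v sgraph) \<Rightarrow> 'v set \<Rightarrow> bool" where
  "amalgamable I G J \<longleftrightarrow>
     (\<forall>i \<in> I. J \<subseteq> verts (G i)) \<and>
     (\<forall>i \<in> I. \<forall>j \<in> I. i \<noteq> j \<longrightarrow> verts (G i) \<inter> verts (G j) = J) \<and>
     (\<forall>i \<in> I. \<forall>j \<in> I. induced (G i) J = induced (G j) J)"

text \<open>For an amalgamable family all sets \<open>edges (induced (G i) J)\<close> coincide, so their union is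
  the edge set of the common induced subgraph on \<open>J\<close>.\<close>

definition amalgam :: "'i set \<Rightarrow> ('i \<Rightarrow> 'v sgraph) \<Rightarrow> 'v set \<Rightarrow> 'v sgraph" where
  "amalgam I G J =
     \<lparr>verts = (\<Union>i \<in> I. verts (G i) - J) \<union> J,
      edges = (\<Union>i \<in> I. edges (G i) - edges (induced (G i) J))
            \<union> (\<Union>i \<in> I. edges (induced (G i) J))\<rparr>"

text \<open>For a list of graphs that may be repeated or overlap outside \<open>J\<close>, the \<open>i\<close>-th graph is
  replaced by a copy in which the vertices outside \<open>J\<close> carry the tag \<open>i\<close>, while all copies share
  \<open>Inl ` J\<close>.\<close>

definition tag_outside :: "'v set \<Rightarrow> nat \<Rightarrow> 'v \<Rightarrow> 'v + nat \<times> 'v" where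
  "tag_outside J i v = (if v \<in> J then Inl v else Inr (i, v))"

definition amalgam_list :: "'v sgraph list \<Rightarrow> 'v set \<Rightarrow> ('v + nat \<times> 'v) sgraph" where
  "amalgam_list Gs J =
     amalgam {..<length Gs} (\<lambda>i. map_graph (tag_outside J i) (Gs ! i)) (Inl ` J)"

lemma inj_tag_outside: "inj (tag_outside J i)"
  by (auto simp: inj_def tag_outside_def split: if_splits)

lemma induced_tag_outside:
  "induced (map_graph (tag_outside J i) G) (Inl ` J) = map_graph Inl (induced G J)"
proof -
  have sub: "tag_outside J i ` e \<subseteq> Inl ` J \<longleftrightarrow> e \<subseteq> J" for e
    by (auto simp: tag_outside_def split: if_splits)
  have eq: "tag_outside J i ` e = Inl ` e" if "e \<subseteq> J" for e
    using that by (intro image_cong) (auto simp: tag_outside_def)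
  have "{e \<in> (\<lambda>e. tag_outside J i ` e) ` edges G. e \<subseteq> Inl ` J}
      = (\<lambda>e. tag_outside J i ` e) ` {e \<in> edges G. e \<subseteq> J}"
    using sub by auto
  also have "\<dots> = (\<lambda>e. Inl ` e) ` {e \<in> edges G. e \<subseteq> J}"
    by (intro image_cong refl eq) simp
  finally show ?thesis
    by (simp add: induced_def map_graph_def)
qed

lemma amalgamable_tag_outside:
  fixes Gs :: "'v sgraph list"
  assumes "\<And>H. H \<in> set Gs \<Longrightarrow> J \<subseteq> verts H"
    and "\<And>H K. H \<in> set Gs \<Longrightarrow> K \<in> set Gs \<Longrightarrow> induced H J = induced K J"
  shows "amalgamable {..<length Gs} (\<lambda>i. map_graph (tag_outside J i) (Gs ! i)) (Inl ` J)"
proof -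
  have sub: "Inl ` J \<subseteq> verts (map_graph (tag_outside J i) (Gs ! i))" if "i < length Gs" for i
  proof
    fix x :: "'v + nat \<times> 'v"
    assume "x \<in> Inl ` J"
    then obtain u where u: "u \<in> J" "x = Inl u" by auto
    then have "u \<in> verts (Gs ! i)" using assms(1) that nth_mem by blast
    with u show "x \<in> verts (map_graph (tag_outside J i) (Gs ! i))"
      by (force simp: map_graph_def tag_outside_def)
  qed
  have le: "verts (map_graph (tag_outside J i) (Gs ! i)) \<inter> verts (map_graph (tag_outside J j) (Gs ! j))
        \<subseteq> Inl ` J" if "i \<noteq> j" for i j
    using that by (auto simp: map_graph_def tag_outside_def split: if_splits)
  show ?thesis
    unfolding amalgamable_def induced_tag_outside
  proof (intro conjI ballI impI)
    fix i j assume "i \<in> {..<length Gs}" "j \<in> {..<length Gs}"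
    then have "induced (Gs ! i) J = induced (Gs ! j) J"
      using assms(2) by simp
    then show "map_graph Inl (induced (Gs ! i) J) = (map_graph Inl (induced (Gs ! j) J)
        :: ('v + nat \<times> 'v) sgraph)"
      by simp
  next
    fix i j assume "i \<in> {..<length Gs}" "j \<in> {..<length Gs}" "i \<noteq> j"
    then show "verts (map_graph (tag_outside J i) (Gs ! i)) \<inter>
        verts (map_graph (tag_outside J j) (Gs ! j)) = Inl ` J"
      using sub[of i] sub[of j] le[of i j] by (intro equalityI Int_greatest) simp_all
  qed (use sub in simp)
qed

lemma graph_iso_map_graph:
  assumes "inj f"
  shows "graph_iso G (map_graph f G)"
  unfolding graph_iso_def
proof (intro exI[of _ f] conjI ballI)
  show "bij_betw f (verts G) (verts (map_graph f G))"
    using assms by (auto simp: map_graph_def bij_betw_def intro: inj_on_subset)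
next
  fix u v
  have "f ` {u, v} \<in> (\<lambda>e. f ` e) ` edges G \<longleftrightarrow> {u, v} \<in> edges G"
    using assms by (intro inj_image_mem_iff inj_onI) (simp add: inj_image_eq_iff)
  then show "{u, v} \<in> edges G \<longleftrightarrow> {f u, f v} \<in> edges (map_graph f G)"
    by (simp add: map_graph_def)
qed

lemma induced_AmB: "induced (AmB A G J) (Inl ` J) = map_graph Inl (induced G J)"
proof -
  have 1: "{e \<in> (\<lambda>e. Inr ` e) ` edges (double_cover H). e \<subseteq> Inl ` J} = {}"
    for H :: "'a sgraph"
    by (auto simp: double_cover_def)
  have "edges (induced (AmB A G J) (Inl ` J))
      = {e \<in> (\<lambda>e. Inl ` e) ` edges (induced G J). e \<subseteq> Inl ` J}"
    using 1[of "delete_verts G J"] by (auto simp: induced_def AmB_def)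
  also have "\<dots> = (\<lambda>e. Inl ` e) ` edges (induced G J)"
    by (auto simp: induced_def)
  finally show ?thesis
    by (simp add: induced_def map_graph_def)
qed

lemma induced_map_Inl: "induced (map_graph Inl G) (Inl ` J) = map_graph Inl (induced G J)"
proof -
  have "Inl ` e \<subseteq> Inl ` J \<longleftrightarrow> e \<subseteq> J" for e by auto
  then show ?thesis by (auto simp: induced_def map_graph_def)
qed

text \<open>To be amalgamated with \<open>AmB A G J\<close>, the graph \<open>G\<close> is moved to the same vertex type along
  \<open>Inl\<close>; both graphs then literally contain \<open>Inl ` J\<close> and induce the same subgraph on it.\<close>

lemma amalgamable_AmB:
  assumes "J \<subseteq> verts G" "set Gs \<subseteq> {map_graph Inl G, AmB A G J}"
  shows "amalgamable {..<length Gs}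
    (\<lambda>i. map_graph (tag_outside (Inl ` J) i) (Gs ! i)) (Inl ` Inl ` J)"
proof (rule amalgamable_tag_outside)
  fix H assume "H \<in> set Gs"
  then have "H = map_graph Inl G \<or> H = AmB A G J" using assms(2) by auto
  then show "Inl ` J \<subseteq> verts H" using assms(1) by (auto simp: map_graph_def AmB_def)
next
  fix H K assume "H \<in> set Gs" "K \<in> set Gs"
  then have "H \<in> {map_graph Inl G, AmB A G J}" "K \<in> {map_graph Inl G, AmB A G J}"
    using assms(2) by auto
  then show "induced H (Inl ` J) = induced K (Inl ` J)"
    by (auto simp: induced_map_Inl induced_AmB)
qed

lemma simple_graph_AmB:
  assumes "simple_graph G" "J \<subseteq> verts G" "A \<subseteq> verts (delete_verts G J)"
  shows "simple_graph (AmB A G J)"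
  unfolding simple_graph_def
proof
  fix e assume "e \<in> edges (AmB A G J)"
  then consider
      (cover) x y where "{x, y} \<in> edges G" "{x, y} \<subseteq> verts G - J" "e = {Inr (x, 0), Inr (y, 1)}"
    | (matching) v where "v \<in> A" "e = {Inr (v, 0), Inr (v, 1)}"
    | (inner) d where "d \<in> edges G" "d \<subseteq> J" "e = Inl ` d"
    | (join) u v i where "u \<in> J" "v \<in> verts G - J" "e = {Inl u, Inr (v, i)}"
    unfolding AmB_def double_cover_def delete_verts_def induced_def by auto
  then show "\<exists>u\<in>verts (AmB A G J). \<exists>v\<in>verts (AmB A G J). u \<noteq> v \<and> e = {u, v}"
  proof cases
    case cover
    then show ?thesis
      by (intro bexI[of _ "Inr (x, 0)"] bexI[of _ "Inr (y, 1)"])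
         (auto simp: AmB_def double_cover_def delete_verts_def induced_def)
  next
    case matching
    then have "v \<in> verts G - J" using assms(3) by (auto simp: delete_verts_def induced_def)
    with matching show ?thesis
      by (intro bexI[of _ "Inr (v, 0)"] bexI[of _ "Inr (v, 1)"])
         (auto simp: AmB_def double_cover_def delete_verts_def induced_def)
  next
    case inner
    then obtain x y where "x \<noteq> y" "d = {x, y}" using assms(1) by (auto simp: simple_graph_def)
    with inner show ?thesis
      by (intro bexI[of _ "Inl x"] bexI[of _ "Inl y"]) (auto simp: AmB_def)
  next
    case join
    then show ?thesis
      by (intro bexI[of _ "Inl u"] bexI[of _ "Inr (v, i)"])
         (auto simp: AmB_def double_cover_def delete_verts_def induced_def)
  qed
qed


section \<open>Von Neumann regular rings\<close>

definition von_neumann_regular :: "('a, 'm) ring_scheme \<Rightarrow> bool" where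
  "von_neumann_regular S \<longleftrightarrow> ring S \<and>
     (\<forall>x \<in> carrier S. \<exists>y \<in> carrier S. x \<otimes>\<^bsub>S\<^esub> y \<otimes>\<^bsub>S\<^esub> x = x)"

definition reg_graph :: "('a, 'm) ring_scheme \<Rightarrow> 'a sgraph" where
  "reg_graph S =
     \<lparr>verts = carrier S - {\<zero>\<^bsub>S\<^esub>},
      edges = {{a, b} | a b. a \<in> carrier S - {\<zero>\<^bsub>S\<^esub>} \<and> b \<in> carrier S - {\<zero>\<^bsub>S\<^esub>} \<and> a \<noteq> b \<and>
                 (a \<otimes>\<^bsub>S\<^esub> b \<otimes>\<^bsub>S\<^esub> a = a \<or> b \<otimes>\<^bsub>S\<^esub> a \<otimes>\<^bsub>S\<^esub> b = b)}\<rparr>"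

lemma simple_graph_reg_graph: "simple_graph (reg_graph S)"
  by (auto simp: simple_graph_def reg_graph_def)

abbreviation F2 :: "int ring" where
  "F2 \<equiv> residue_ring 2"

lemma field_F2: "field F2"
  using residues_prime.is_field[of 2] by (simp add: residues_prime_def)

lemma card_F2: "card (carrier F2) = 2"
  by (simp add: residue_ring_def)

lemma reg_graph_F2_parts:
  fixes R :: "('a, 'm) ring_scheme"
  defines "G \<equiv> reg_graph (RDirProd R F2)"
    and "J \<equiv> {(u, \<zero>\<^bsub>F2\<^esub>) | u. u \<in> carrier R - {\<zero>\<^bsub>R\<^esub>}}"
  shows "J \<subseteq> verts G"
    and "verts (delete_verts G J) = carrier R \<times> {\<one>\<^bsub>F2\<^esub>}"
proof -
  have zero: "\<zero>\<^bsub>RDirProd R F2\<^esub> = (\<zero>\<^bsub>R\<^esub>, \<zero>\<^bsub>F2\<^esub>)"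
    by (simp add: RDirProd_def DirProd_def monoid.defs)
  have F2: "carrier F2 = {0, 1}" "\<zero>\<^bsub>F2\<^esub> = 0" "\<one>\<^bsub>F2\<^esub> = 1"
    by (auto simp: residue_ring_def)
  show "J \<subseteq> verts G" "verts (delete_verts G J) = carrier R \<times> {\<one>\<^bsub>F2\<^esub>}"
    by (auto simp: G_def J_def reg_graph_def delete_verts_def induced_def RDirProd_carrier zero F2)
qed

end

(* The vertices of J see every coordinate of F in the same way: (a, 0) is adjacent to (b, y) with
   y nonzero iff a b a = a, whatever y is.  For nonzero x and y, adjacency of (a, x) and (b, y)
   forces x y = 1, so outside J the graph splits according to the orbits of inversion on the
   units of F.  A fixed point (1 or -1) contributes a copy of G.  A two-element orbit contributes
   the double cover of G - J, where moreover (a, x) and (a, 1/x) are adjacent exactly when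
   a^3 = a.  The numbers of orbits follow from the parity of |F| alone: one or two units are
   fixed and the other units pair up, so just one is fixed iff |F| is even. *)

theory Submission
  imports Defs
begin

section \<open>Enumerating the orbits of an involution\<close>

text \<open>Orbits are split off one at a time: removing a whole orbit \<open>{z, s z}\<close>
  leaves a set still closed under \<open>s\<close>. The value \<open>g x\<close> holds the number of
  the orbit of \<open>x\<close> and a bit telling its two elements apart; the bit later becomes the
  sheet of the double cover.\<close>

lemma fixpoint_free_involution_enum:
  assumes "finite X" and "\<And>x. x \<in> X \<Longrightarrow> s x \<in> X" and "\<And>x. x \<in> X \<Longrightarrow> s (s x) = x"
    and "\<And>x. x \<in> X \<Longrightarrow> s x \<noteq> x"
  shows "\<exists>(g :: 'a \<Rightarrow> nat \<times> bit) m. bij_betw g X ({..<m} \<times> UNIV) \<and> card X = 2 * m \<and>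
    (\<forall>x\<in>X. \<forall>y\<in>X. y = s x \<longleftrightarrow> fst (g x) = fst (g y) \<and> snd (g x) \<noteq> snd (g y))"
  using assms
proof (induction X rule: finite_psubset_induct)
  case (psubset X)
  show ?case
  proof (cases "X = {}")
    case True
    then show ?thesis by (auto simp: bij_betw_def)
  next
    case False
    then obtain z where z: "z \<in> X" by blast
    define Y where "Y = X - {z, s z}"
    have sz: "s z \<in> X" "s z \<noteq> z" "s (s z) = z" using psubset.prems z by auto
    have "Y \<subset> X" using z by (auto simp: Y_def)
    moreover have sY: "s x \<in> Y" if "x \<in> Y" for x
      using that psubset.prems(1,2)[of x] sz by (auto simp: Y_def)
    ultimately have "\<exists>(g :: 'a \<Rightarrow> nat \<times> bit) m. bij_betw g Y ({..<m} \<times> UNIV) \<and> card Y = 2 * m \<and>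
        (\<forall>x\<in>Y. \<forall>y\<in>Y. y = s x \<longleftrightarrow> fst (g x) = fst (g y) \<and> snd (g x) \<noteq> snd (g y))"
      by (rule psubset.IH) (use psubset.prems in \<open>auto simp: Y_def\<close>)
    then obtain g :: "'a \<Rightarrow> nat \<times> bit" and m where
      g: "bij_betw g Y ({..<m} \<times> UNIV)" "card Y = 2 * m"
      and gs: "\<And>x y. x \<in> Y \<Longrightarrow> y \<in> Y \<Longrightarrow>
        y = s x \<longleftrightarrow> fst (g x) = fst (g y) \<and> snd (g x) \<noteq> snd (g y)"
      by blast
    \<comment> \<open>The indices used on \<open>Y\<close> all lie below \<open>m\<close>, so
      \<open>m\<close> is free for the new orbit.\<close>
    define g' where "g' = g(z := (m, 0), s z := (m, 1))"
    have X: "X = insert z (insert (s z) Y)" "z \<notin> Y" "s z \<notin> Y"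
      using z sz by (auto simp: Y_def)
    have g'Y: "g' x = g x" if "x \<in> Y" for x
      using that X by (auto simp: g'_def)
    have g'z: "g' z = (m, 0)" "g' (s z) = (m, 1)"
      using sz by (auto simp: g'_def)
    have lt: "fst (g x) < m" if "x \<in> Y" for x
      using bij_betwE[OF g(1)] that by (auto simp: mem_Times_iff)
    have "bij_betw g' X ({..<Suc m} \<times> UNIV)"
      unfolding bij_betw_def
    proof
      have "inj_on g' Y"
        using g(1) g'Y by (auto simp: bij_betw_def inj_on_def)
      then show "inj_on g' X"
        using X sz g'z g'Y lt by (fastforce simp: inj_on_def)
      have "g' ` Y = {..<m} \<times> UNIV"
        using g(1) g'Y by (auto simp: bij_betw_def)
      moreover have "({..<Suc m} \<times> UNIV) = insert (m, 0) (insert (m, 1) ({..<m} \<times> (UNIV :: bit set)))"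
        by (auto simp: less_Suc_eq)
      ultimately show "g' ` X = {..<Suc m} \<times> UNIV"
        using X g'z by simp
    qed
    moreover have "card X = 2 * Suc m"
      using X sz g(2) psubset.hyps by (simp add: X(1))
    moreover have "y = s x \<longleftrightarrow> fst (g' x) = fst (g' y) \<and> snd (g' x) \<noteq> snd (g' y)"
      if xyX: "x \<in> X" "y \<in> X" for x y
    proof -
      consider "x \<in> Y" "y \<in> Y" | "x \<in> Y" "y = z \<or> y = s z" | "y \<in> Y" "x = z \<or> x = s z"
        | "x = z \<or> x = s z" "y = z \<or> y = s z"
        using xyX X by blast
      then show ?thesis
      proof cases
        case 1 then show ?thesis using gs g'Y by simp
      next
        case 2
        then have "y \<noteq> s x" using 2 sY[of x] X by auto
        moreover have "fst (g' x) \<noteq> fst (g' y)" using 2 lt[of x] g'Y g'z by auto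
        ultimately show ?thesis by simp
      next
        case 3
        then have "y \<noteq> s x" using sz X by auto
        moreover have "fst (g' x) \<noteq> fst (g' y)" using 3 lt[of y] g'Y g'z by auto
        ultimately show ?thesis by simp
      next
        case 4 then show ?thesis using sz g'z by auto
      qed
    qed
    ultimately show ?thesis by blast
  qed
qed

text \<open>Fixed points and two-element orbits are numbered separately, fixed points first, so that
  the numbering matches the order of the list to be amalgamated. The tag \<open>None\<close> marks a
  fixed point, its own partner; \<open>Some b\<close> marks one element of a genuine pair. One
  formula then describes \<open>y = s x\<close> in both cases.\<close>

lemma involution_enum:
  fixes s :: "'a \<Rightarrow> 'a"
  assumes "finite X" and "\<And>x. x \<in> X \<Longrightarrow> s x \<in> X" and "\<And>x. x \<in> X \<Longrightarrow> s (s x) = x"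
  shows "\<exists>(h :: 'a \<Rightarrow> nat \<times> bit option) m.
    bij_betw h X ({..<card {x \<in> X. s x = x}} \<times> {None} \<union>
      {card {x \<in> X. s x = x}..<card {x \<in> X. s x = x} + m} \<times> range Some) \<and>
    card X = card {x \<in> X. s x = x} + 2 * m \<and>
    (\<forall>x\<in>X. \<forall>y\<in>X. y = s x \<longleftrightarrow> fst (h x) = fst (h y) \<and> (snd (h x) = None \<or> snd (h x) \<noteq> snd (h y)))"
proof -
  define E where "E = {x \<in> X. s x = x}"
  define Y where "Y = X - E"
  define c where "c = card E"
  have fin: "finite E" "finite Y" using assms(1) by (auto simp: E_def Y_def)
  have X: "X = E \<union> Y" "E \<inter> Y = {}" by (auto simp: E_def Y_def)
  have sY: "s x \<in> Y" "s (s x) = x" "s x \<noteq> x" if "x \<in> Y" for x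
    using that assms(2,3) by (auto simp: E_def Y_def)
  obtain g :: "'a \<Rightarrow> nat \<times> bit" and m where g: "bij_betw g Y ({..<m} \<times> UNIV)" "card Y = 2 * m"
    and gs: "\<And>x y. x \<in> Y \<Longrightarrow> y \<in> Y \<Longrightarrow>
      y = s x \<longleftrightarrow> fst (g x) = fst (g y) \<and> snd (g x) \<noteq> snd (g y)"
    using fixpoint_free_involution_enum[of Y s, OF fin(2) sY] by blast
  obtain e where e: "bij_betw e E {..<c}"
    using fin(1) ex_bij_betw_finite_nat[of E] by (auto simp: c_def atLeast0LessThan)
  \<comment> \<open>The shift by \<open>c\<close> keeps the two index ranges disjoint, so the index
    alone tells a fixed point from a pair.\<close>
  define h where "h = (\<lambda>x. if x \<in> E then (e x, None) else (c + fst (g x), Some (snd (g x))))"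
  have hE: "h x = (e x, None)" if "x \<in> E" for x using that by (simp add: h_def)
  have hY: "h x = (c + fst (g x), Some (snd (g x)))" if "x \<in> Y" for x
    using that by (auto simp: h_def Y_def)
  have "bij_betw h E ({..<c} \<times> {None})"
    using e hE by (auto simp: bij_betw_def inj_on_def image_iff)
  moreover have "bij_betw h Y ({c..<c + m} \<times> range Some)"
    unfolding bij_betw_def
  proof
    show "inj_on h Y"
      using g(1) hY by (auto simp: bij_betw_def inj_on_def prod_eq_iff)
    have "h ` Y = (\<lambda>(i, b). (c + i, Some b)) ` g ` Y"
      using hY by (auto simp: image_iff split_beta)
    also have "g ` Y = {..<m} \<times> UNIV" using g(1) by (simp add: bij_betw_def)
    also have "(\<lambda>(i, b). (c + i, Some b)) ` ({..<m} \<times> (UNIV :: bit set)) = {c..<c + m} \<times> range Some"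
    proof (intro equalityI subsetI)
      fix w :: "nat \<times> bit option" assume "w \<in> {c..<c + m} \<times> range Some"
      then obtain j b where "w = (j, Some b)" "c \<le> j" "j < c + m" by auto
      then show "w \<in> (\<lambda>(i, b). (c + i, Some b)) ` ({..<m} \<times> UNIV)"
        by (intro image_eqI[of _ _ "(j - c, b)"]) auto
    qed auto
    finally show "h ` Y = {c..<c + m} \<times> range Some" .
  qed
  ultimately have "bij_betw h X ({..<c} \<times> {None} \<union> {c..<c + m} \<times> range Some)"
    unfolding X(1) by (rule bij_betw_combine) auto
  moreover have "card X = c + 2 * m"
    using X fin g(2) by (simp add: card_Un_disjoint c_def)
  moreover have "y = s x \<longleftrightarrow> fst (h x) = fst (h y) \<and> (snd (h x) = None \<or> snd (h x) \<noteq> snd (h y))"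
    if "x \<in> X" "y \<in> X" for x y
  proof -
    have eE: "e u < c" if "u \<in> E" for u using bij_betwE[OF e] that by auto
    consider "x \<in> E" "y \<in> E" | "x \<in> E" "y \<in> Y" | "x \<in> Y" "y \<in> E" | "x \<in> Y" "y \<in> Y"
      using \<open>x \<in> X\<close> \<open>y \<in> X\<close> X by blast
    then show ?thesis
    proof cases
      case 1
      then have "s x = x" by (simp add: E_def)
      moreover have "e x = e y \<longleftrightarrow> x = y" using e 1 by (auto simp: bij_betw_def inj_on_def)
      ultimately show ?thesis using 1 by (auto simp: hE)
    next
      case 2
      then have "s x = x" by (simp add: E_def)
      then have "y \<noteq> s x" using 2 X(2) by auto
      then show ?thesis using 2 eE[of x] by (auto simp: hE hY)
    next
      case 3
      then have "y \<noteq> s x" using sY(1)[of x] X by auto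
      then show ?thesis using 3 eE[of y] by (auto simp: hE hY)
    next
      case 4
      then show ?thesis using gs by (simp add: hY)
    qed
  qed
  ultimately show ?thesis unfolding c_def E_def by blast
qed

text \<open>Inversion is an involution on the nonzero elements, and its orbits are exactly what the
  relation \<open>x \<otimes> y = \<one>\<close> sees. Its fixed points are \<open>\<one>\<close>
  and \<open>\<ominus> \<one>\<close>, which may coincide; parity of the order decides whether they
  do.\<close>

lemma (in field) units_enum:
  fixes n :: nat
  assumes "finite (carrier R)"
  defines "c \<equiv> (if even (order R) then 1 else 2)"
  shows "\<exists>h :: 'a \<Rightarrow> nat \<times> bit option. bij_betw h (carrier R - {\<zero>})
      ({..<c} \<times> {None} \<union> {c..<c + (order R - 1 - c) div 2} \<times> range Some) \<and>
    (\<forall>x\<in>carrier R - {\<zero>}. \<forall>y\<in>carrier R - {\<zero>}.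
      x \<otimes> y = \<one> \<longleftrightarrow> fst (h x) = fst (h y) \<and> (snd (h x) = None \<or> snd (h x) \<noteq> snd (h y)))"
proof -
  let ?X = "carrier R - {\<zero>}"
  have units: "Units R = ?X" by (rule field_Units)
  \<comment> \<open>A self-inverse unit squares to \<open>\<one>\<close>, and in a domain this
    leaves only \<open>\<one>\<close> and \<open>\<ominus> \<one>\<close>.\<close>
  have fix_iff: "{x \<in> ?X. inv x = x} = {\<one>, \<ominus> \<one>}"
  proof (intro equalityI subsetI)
    fix x assume "x \<in> {x \<in> ?X. inv x = x}"
    then show "x \<in> {\<one>, \<ominus> \<one>}" using inv_eq_self[of x] units by auto
  next
    fix x assume "x \<in> {\<one>, \<ominus> \<one>}"
    then have "x \<in> carrier R" "x \<otimes> x = \<one>" by (auto simp: l_minus r_minus)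
    moreover from this have "x \<noteq> \<zero>" by auto
    ultimately show "x \<in> {x \<in> ?X. inv x = x}"
      using comm_inv_char[of x x] by auto
  qed
  have fin: "finite ?X" using assms(1) by simp
  have cl: "inv x \<in> ?X" if "x \<in> ?X" for x using that units Units_inv_Units by blast
  have idem: "inv (inv x) = x" if "x \<in> ?X" for x using that units Units_inv_inv by blast
  obtain h :: "'a \<Rightarrow> nat \<times> bit option" and m where
    h: "bij_betw h ?X ({..<card {\<one>, \<ominus> \<one>}} \<times> {None} \<union>
          {card {\<one>, \<ominus> \<one>}..<card {\<one>, \<ominus> \<one>} + m} \<times> range Some)"
    and card: "card ?X = card {\<one>, \<ominus> \<one>} + 2 * m"
    and hs: "\<And>x y. x \<in> ?X \<Longrightarrow> y \<in> ?X \<Longrightarrow>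
      y = inv x \<longleftrightarrow> fst (h x) = fst (h y) \<and> (snd (h x) = None \<or> snd (h x) \<noteq> snd (h y))"
    using involution_enum[of ?X "\<lambda>x. inv x", OF fin cl idem] unfolding fix_iff by blast
  have ord: "order R = Suc (card ?X)"
    unfolding order_def using assms(1) by (metis card.remove zero_closed)
  \<comment> \<open>The order is one more than this cardinality plus \<open>2 * m\<close>. Its
    parity therefore separates the values 1 and 2, and the division by 2 that recovers
    \<open>m\<close> is exact.\<close>
  have "card {\<one>, \<ominus> \<one>} = 1 \<or> card {\<one>, \<ominus> \<one>} = 2" by (auto simp: card_insert_if)
  then have c: "card {\<one>, \<ominus> \<one>} = c" and m: "m = (order R - 1 - c) div 2"
    using ord card by (auto simp: c_def)
  have "y = inv x \<longleftrightarrow> x \<otimes> y = \<one>" if "x \<in> ?X" "y \<in> ?X" for x y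
    using that units comm_inv_char[of x y] by (metis DiffD1 Units_r_inv)
  then have "\<forall>x\<in>?X. \<forall>y\<in>?X.
      x \<otimes> y = \<one> \<longleftrightarrow> fst (h x) = fst (h y) \<and> (snd (h x) = None \<or> snd (h x) \<noteq> snd (h y))"
    using hs by blast
  then show ?thesis using h unfolding c m by blast
qed

section \<open>Edges of the constructed graphs\<close>

text \<open>Since \<open>d\<close> is unordered, its elements can be named in the order of
  \<open>x\<close> and \<open>y\<close>. Edges of an image graph can thus be pulled back endpoint by
  endpoint.\<close>

lemma doubleton_eq_image_iff:
  assumes "inj f"
  shows "{x, y} = f ` d \<longleftrightarrow> (\<exists>u v. d = {u, v} \<and> x = f u \<and> y = f v)"
proof
  assume eq: "{x, y} = f ` d"
  then obtain u v where uv: "u \<in> d" "v \<in> d" "x = f u" "y = f v" by (metis imageE insertCI)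
  then have "f ` {u, v} = f ` d" using eq by simp
  then have "d = {u, v}" using assms by (metis inj_image_eq_iff)
  then show "\<exists>u v. d = {u, v} \<and> x = f u \<and> y = f v" using uv by blast
qed auto

lemma edge_map_graph_iff:
  assumes "inj f"
  shows "{x, y} \<in> edges (map_graph f G) \<longleftrightarrow> (\<exists>u v. {u, v} \<in> edges G \<and> x = f u \<and> y = f v)"
  by (auto simp: map_graph_def image_iff doubleton_eq_image_iff[OF assms])

lemma edge_map_Inl_iff: "{Inl u, Inl v} \<in> edges (map_graph Inl G) \<longleftrightarrow> {u, v} \<in> edges G"
  by (simp add: edge_map_graph_iff)

text \<open>The tags of the two endpoints determine which edge families can contribute. Cover edges
  run from sheet 0 to sheet 1, but \<open>{v, w}\<close> may be read in either order, so only
  \<open>b \<noteq> b'\<close> remains of the orientation.\<close>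

lemma edge_AmB_iffs:
  "{Inl u, Inl v} \<in> edges (AmB A G J) \<longleftrightarrow> u \<in> J \<and> v \<in> J \<and> {u, v} \<in> edges G"
  "{Inl u, Inr (v, b)} \<in> edges (AmB A G J) \<longleftrightarrow> u \<in> J \<and> v \<in> verts G - J \<and> {u, v} \<in> edges G"
  "{Inr (v, b), Inr (w, b')} \<in> edges (AmB A G J) \<longleftrightarrow>
    b \<noteq> b' \<and> (v \<in> verts G - J \<and> w \<in> verts G - J \<and> {v, w} \<in> edges G \<or> v = w \<and> v \<in> A)"
proof -
  have 1: "x = 0 \<or> x = 1" for x :: bit by (cases "x = 0") auto
  show "{Inl u, Inl v} \<in> edges (AmB A G J) \<longleftrightarrow> u \<in> J \<and> v \<in> J \<and> {u, v} \<in> edges G"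
    by (auto simp: AmB_def induced_def doubleton_eq_image_iff image_iff double_cover_def)
  show "{Inl u, Inr (v, b)} \<in> edges (AmB A G J) \<longleftrightarrow> u \<in> J \<and> v \<in> verts G - J \<and> {u, v} \<in> edges G"
    by (auto simp: AmB_def induced_def delete_verts_def doubleton_eq_image_iff image_iff
          doubleton_eq_iff double_cover_def)
  show "{Inr (v, b), Inr (w, b')} \<in> edges (AmB A G J) \<longleftrightarrow>
    b \<noteq> b' \<and> (v \<in> verts G - J \<and> w \<in> verts G - J \<and> {v, w} \<in> edges G \<or> v = w \<and> v \<in> A)"
    using 1[of b] 1[of b']
    by (auto simp: AmB_def induced_def delete_verts_def doubleton_eq_image_iff image_iff
          doubleton_eq_iff double_cover_def insert_commute)
qed

lemma verts_amalgam_list: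
  assumes "Gs \<noteq> []"
  shows "verts (amalgam_list Gs J) = Inl ` J \<union> {Inr (i, w) | i w. i < length Gs \<and> w \<in> verts (Gs ! i) - J}"
  using assms by (fastforce simp: amalgam_list_def amalgam_def map_graph_def tag_outside_def)

text \<open>Edges inside \<open>J\<close> are subtracted from each graph and then added back, so the
  edge set is simply the union of the edge sets of the tagged copies.\<close>

lemma edge_amalgam_list_iff:
  "{x, y} \<in> edges (amalgam_list Gs J) \<longleftrightarrow>
    (\<exists>i<length Gs. \<exists>u v. {u, v} \<in> edges (Gs ! i) \<and> x = tag_outside J i u \<and> y = tag_outside J i v)"
proof -
  have "edges (amalgam_list Gs J) = (\<Union>i<length Gs. edges (map_graph (tag_outside J i) (Gs ! i)))"
    by (auto simp: amalgam_list_def amalgam_def induced_def)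
  then show ?thesis by (auto simp: edge_map_graph_iff[OF inj_tag_outside])
qed

text \<open>An endpoint outside \<open>J\<close> carries the index of its graph and forces the edge
  to come from there. An edge inside \<open>J\<close> carries no index, hence the existential
  quantifier in the first case.\<close>

lemma edge_amalgam_list_iffs:
  "{Inl u, Inl v} \<in> edges (amalgam_list Gs J) \<longleftrightarrow>
    u \<in> J \<and> v \<in> J \<and> (\<exists>i<length Gs. {u, v} \<in> edges (Gs ! i))"
  "{Inl u, Inr (i, w)} \<in> edges (amalgam_list Gs J) \<longleftrightarrow>
    i < length Gs \<and> u \<in> J \<and> w \<notin> J \<and> {u, w} \<in> edges (Gs ! i)"
  "{Inr (i, v), Inr (j, w)} \<in> edges (amalgam_list Gs J) \<longleftrightarrow>
    i = j \<and> i < length Gs \<and> v \<notin> J \<and> w \<notin> J \<and> {v, w} \<in> edges (Gs ! i)"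
  unfolding edge_amalgam_list_iff by (auto simp: tag_outside_def split: if_splits)

section \<open>The graph of a product with a field\<close>

lemma zero_RDirProd: "\<zero>\<^bsub>RDirProd R S\<^esub> = (\<zero>\<^bsub>R\<^esub>, \<zero>\<^bsub>S\<^esub>)"
  by (simp add: RDirProd_def DirProd_def monoid.defs)

lemma mult_RDirProd: "(a, x) \<otimes>\<^bsub>RDirProd R S\<^esub> (b, y) = (a \<otimes>\<^bsub>R\<^esub> b, x \<otimes>\<^bsub>S\<^esub> y)"
  by (simp add: RDirProd_def DirProd_def monoid.defs)

lemma edge_reg_graph_iff:
  "{a, b} \<in> edges (reg_graph S) \<longleftrightarrow>
    a \<in> carrier S - {\<zero>\<^bsub>S\<^esub>} \<and> b \<in> carrier S - {\<zero>\<^bsub>S\<^esub>} \<and> a \<noteq> b \<and>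
    (a \<otimes>\<^bsub>S\<^esub> b \<otimes>\<^bsub>S\<^esub> a = a \<or> b \<otimes>\<^bsub>S\<^esub> a \<otimes>\<^bsub>S\<^esub> b = b)"
  by (auto simp: reg_graph_def doubleton_eq_iff)

text \<open>A nonzero \<open>x\<close> can be cancelled. This turns the regularity condition in the
  field coordinate into being mutually inverse.\<close>

lemma (in field) mult_mult_self_eq_iff:
  assumes "x \<in> carrier R" "y \<in> carrier R"
  shows "x \<otimes> y \<otimes> x = x \<longleftrightarrow> x = \<zero> \<or> x \<otimes> y = \<one>"
proof (cases "x = \<zero>")
  case False
  then have "x \<otimes> y \<otimes> x = \<one> \<otimes> x \<longleftrightarrow> x \<otimes> y = \<one>"
    using assms by (intro m_rcancel) auto
  then show ?thesis using False assms by simp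
qed (use assms in simp)

text \<open>The conditions are checked coordinatewise. If just one field coordinate is zero, the
  disjunct that must reproduce the nonzero one fails, and the other holds trivially in the field, so
  the value of \<open>y\<close> disappears. If both are nonzero, either disjunct forces them to be
  inverse. Stating this for any field allows the comparison of \<open>F\<close> with
  \<open>F2\<close>.\<close>

lemma edge_product_field_iffs:
  fixes R :: "('a, 'm) ring_scheme" and F :: "('b, 'l) ring_scheme"
  assumes "cring R" "field F" "a \<in> carrier R" "b \<in> carrier R"
  shows "{(a, \<zero>\<^bsub>F\<^esub>), (b, \<zero>\<^bsub>F\<^esub>)} \<in> edges (reg_graph (RDirProd R F)) \<longleftrightarrow> {a, b} \<in> edges (reg_graph R)"
    and "y \<in> carrier F - {\<zero>\<^bsub>F\<^esub>} \<Longrightarrow> {(a, \<zero>\<^bsub>F\<^esub>), (b, y)} \<in> edges (reg_graph (RDirProd R F)) \<longleftrightarrow>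
      a \<noteq> \<zero>\<^bsub>R\<^esub> \<and> a \<otimes>\<^bsub>R\<^esub> b \<otimes>\<^bsub>R\<^esub> a = a"
    and "x \<in> carrier F - {\<zero>\<^bsub>F\<^esub>} \<Longrightarrow> y \<in> carrier F - {\<zero>\<^bsub>F\<^esub>} \<Longrightarrow>
      {(a, x), (b, y)} \<in> edges (reg_graph (RDirProd R F)) \<longleftrightarrow>
      x \<otimes>\<^bsub>F\<^esub> y = \<one>\<^bsub>F\<^esub> \<and> (a, x) \<noteq> (b, y) \<and> (a \<otimes>\<^bsub>R\<^esub> b \<otimes>\<^bsub>R\<^esub> a = a \<or> b \<otimes>\<^bsub>R\<^esub> a \<otimes>\<^bsub>R\<^esub> b = b)"
proof -
  interpret R: cring R by fact
  interpret F: field F by fact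
  show "{(a, \<zero>\<^bsub>F\<^esub>), (b, \<zero>\<^bsub>F\<^esub>)} \<in> edges (reg_graph (RDirProd R F)) \<longleftrightarrow> {a, b} \<in> edges (reg_graph R)"
    using assms by (auto simp: edge_reg_graph_iff zero_RDirProd mult_RDirProd RDirProd_carrier)
  show "{(a, \<zero>\<^bsub>F\<^esub>), (b, y)} \<in> edges (reg_graph (RDirProd R F)) \<longleftrightarrow>
      a \<noteq> \<zero>\<^bsub>R\<^esub> \<and> a \<otimes>\<^bsub>R\<^esub> b \<otimes>\<^bsub>R\<^esub> a = a" if "y \<in> carrier F - {\<zero>\<^bsub>F\<^esub>}"
    using assms that by (auto simp: edge_reg_graph_iff zero_RDirProd mult_RDirProd RDirProd_carrier)
  show "{(a, x), (b, y)} \<in> edges (reg_graph (RDirProd R F)) \<longleftrightarrow>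
      x \<otimes>\<^bsub>F\<^esub> y = \<one>\<^bsub>F\<^esub> \<and> (a, x) \<noteq> (b, y) \<and> (a \<otimes>\<^bsub>R\<^esub> b \<otimes>\<^bsub>R\<^esub> a = a \<or> b \<otimes>\<^bsub>R\<^esub> a \<otimes>\<^bsub>R\<^esub> b = b)"
    if "x \<in> carrier F - {\<zero>\<^bsub>F\<^esub>}" "y \<in> carrier F - {\<zero>\<^bsub>F\<^esub>}"
    using assms that F.mult_mult_self_eq_iff[of x y] F.mult_mult_self_eq_iff[of y x] F.m_comm[of x y]
    by (auto simp: edge_reg_graph_iff zero_RDirProd mult_RDirProd RDirProd_carrier)
qed

text \<open>This isolates the graph theory from the counting: the unit group of \<open>F\<close>
  enters only through the numbering \<open>h\<close> of its inversion orbits, with \<open>c\<close>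
  fixed points and \<open>m\<close> pairs.\<close>

lemma graph_iso_amalgam_list:
  fixes R :: "('a, 'm) ring_scheme" and F :: "('b, 'l) ring_scheme"
    and h :: "'b \<Rightarrow> nat \<times> bit option"
  assumes "cring R" "field F" "c > 0"
    and h: "bij_betw h (carrier F - {\<zero>\<^bsub>F\<^esub>}) ({..<c} \<times> {None} \<union> {c..<c + m} \<times> range Some)"
    and hs: "\<And>x y. x \<in> carrier F - {\<zero>\<^bsub>F\<^esub>} \<Longrightarrow> y \<in> carrier F - {\<zero>\<^bsub>F\<^esub>} \<Longrightarrow>
      x \<otimes>\<^bsub>F\<^esub> y = \<one>\<^bsub>F\<^esub> \<longleftrightarrow> fst (h x) = fst (h y) \<and> (snd (h x) = None \<or> snd (h x) \<noteq> snd (h y))"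
  defines "G \<equiv> reg_graph (RDirProd R F2)"
    and "A \<equiv> {(a, \<one>\<^bsub>F2\<^esub>) | a. a \<in> carrier R \<and> a [^]\<^bsub>R\<^esub> (3::nat) = a}"
    and "J \<equiv> {(u, \<zero>\<^bsub>F2\<^esub>) | u. u \<in> carrier R - {\<zero>\<^bsub>R\<^esub>}}"
  shows "graph_iso (reg_graph (RDirProd R F))
    (amalgam_list (replicate c (map_graph Inl G) @ replicate m (AmB A G J)) (Inl ` J))"
proof -
  interpret R: cring R by fact
  interpret F: field F by fact
  interpret F2: field F2 by (rule field_F2)
  let ?X = "carrier F - {\<zero>\<^bsub>F\<^esub>}"
  define Gs where "Gs = replicate c (map_graph Inl G) @ replicate m (AmB A G J)"
  \<comment> \<open>\<open>None\<close> places a vertex in a copy of \<open>G\<close>, and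
    \<open>Some b\<close> places it in sheet \<open>b\<close> of the double cover.\<close>
  define emb :: "bit option \<Rightarrow> 'a \<times> int \<Rightarrow> ('a \<times> int) + ('a \<times> int) \<times> bit" where
    "emb = (\<lambda>t v. case t of None \<Rightarrow> Inl v | Some b \<Rightarrow> Inr (v, b))"
  \<comment> \<open>The coordinate in \<open>R\<close> is kept. A zero field coordinate leads to the
    shared part, where the outer \<open>Inl\<close> comes from the amalgamation and the inner one
    from the vertex type of \<open>AmB\<close>; a unit \<open>x\<close> leads to the graph numbered
    by its orbit.\<close>
  define f :: "'a \<times> 'b \<Rightarrow>
      (('a \<times> int) + ('a \<times> int) \<times> bit) + nat \<times> (('a \<times> int) + ('a \<times> int) \<times> bit)" where
    "f = (\<lambda>(a, x). if x = \<zero>\<^bsub>F\<^esub> then Inl (Inl (a, \<zero>\<^bsub>F2\<^esub>))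
    else Inr (fst (h x), emb (snd (h x)) (a, \<one>\<^bsub>F2\<^esub>)))"
  have F2: "carrier F2 = {\<zero>\<^bsub>F2\<^esub>, \<one>\<^bsub>F2\<^esub>}" by (auto simp: residue_ring_def)
  have one: "\<one>\<^bsub>F2\<^esub> \<in> carrier F2 - {\<zero>\<^bsub>F2\<^esub>}" by simp
  have ne: "\<one>\<^bsub>F2\<^esub> \<noteq> \<zero>\<^bsub>F2\<^esub>" by simp
  have mem_J: "(a, t) \<in> J \<longleftrightarrow> t = \<zero>\<^bsub>F2\<^esub> \<and> a \<in> carrier R \<and> a \<noteq> \<zero>\<^bsub>R\<^esub>" for a t
    by (auto simp: J_def)
  have vG: "verts G = J \<union> carrier R \<times> {\<one>\<^bsub>F2\<^esub>}"
    using ne by (auto simp: G_def J_def reg_graph_def RDirProd_carrier zero_RDirProd F2)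
  have vGJ: "verts G - J = carrier R \<times> {\<one>\<^bsub>F2\<^esub>}"
    using ne by (auto simp: vG mem_J)
  have len: "length Gs = c + m" "Gs \<noteq> []" using \<open>c > 0\<close> by (auto simp: Gs_def)
  have Gs_lt: "Gs ! i = map_graph Inl G" if "i < c" for i
    using that by (simp add: Gs_def nth_append)
  have Gs_ge: "Gs ! i = AmB A G J" if "c \<le> i" "i < c + m" for i
    using that by (simp add: Gs_def nth_append)
  have slot: "(\<exists>i<c. h x = (i, None)) \<or> (\<exists>i b. c \<le> i \<and> i < c + m \<and> h x = (i, Some b))"
    if "x \<in> ?X" for x
    proof -
    have "h x \<in> {..<c} \<times> {None} \<union> {c..<c + m} \<times> range Some"
      using bij_betwE[OF h] that by blast
    then show ?thesis by (cases "h x") auto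
  qed
  have emb_J: "emb t (a, \<one>\<^bsub>F2\<^esub>) \<notin> Inl ` J" for t a
    using ne by (auto simp: emb_def mem_J split: option.splits)
  have emb_inj: "emb t v = emb t' v' \<longleftrightarrow> t = t' \<and> v = v'" for t t' v v'
    by (auto simp: emb_def split: option.splits)
  \<comment> \<open>Outside the shared part, the graph in position \<open>i\<close> consists of one
    layer indexed by \<open>R\<close> for each tag that occurs with \<open>i\<close>: one layer for
    a copy of \<open>G\<close>, two for \<open>AmB\<close>.\<close>
  have vGs: "w \<in> verts (Gs ! i) - Inl ` J \<longleftrightarrow>
      (\<exists>t. \<exists>a\<in>carrier R. w = emb t (a, \<one>\<^bsub>F2\<^esub>) \<and>
        (i, t) \<in> {..<c} \<times> {None} \<union> {c..<c + m} \<times> range Some)" if "i < c + m" for i w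
  proof (cases "i < c")
    case True
    have "verts (map_graph Inl G) - Inl ` J = Inl ` (verts G - J)"
      by (auto simp: map_graph_def)
    with True show ?thesis
      by (auto simp: Gs_lt vGJ emb_def image_iff)
  next
    case False
    have "verts (AmB A G J) - Inl ` J = Inr ` ((verts G - J) \<times> UNIV)"
      by (auto simp: AmB_def double_cover_def delete_verts_def induced_def)
    with False that show ?thesis
      by (auto simp: Gs_ge vGJ emb_def image_iff split: option.splits)
  qed

  \<comment> \<open>The bijection on vertices\<close>
  have bij: "bij_betw f (verts (reg_graph (RDirProd R F))) (verts (amalgam_list Gs (Inl ` J)))"
    unfolding bij_betw_def
  proof
    have "inj_on h ?X" using h by (simp add: bij_betw_def)
    then show "inj_on f (verts (reg_graph (RDirProd R F)))"
      by (auto simp: inj_on_def f_def reg_graph_def RDirProd_carrier emb_inj prod_eq_iff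
          split: if_splits)
  next
    have him: "h ` ?X = {..<c} \<times> {None} \<union> {c..<c + m} \<times> range Some"
      using h by (simp add: bij_betw_def)
    show "f ` verts (reg_graph (RDirProd R F)) = verts (amalgam_list Gs (Inl ` J))"
    proof (intro equalityI subsetI)
      fix z assume "z \<in> f ` verts (reg_graph (RDirProd R F))"
      then consider a where "a \<in> carrier R - {\<zero>\<^bsub>R\<^esub>}" "z = f (a, \<zero>\<^bsub>F\<^esub>)"
        | a x where "a \<in> carrier R" "x \<in> ?X" "z = f (a, x)"
        by (auto simp: reg_graph_def RDirProd_carrier zero_RDirProd)
      then show "z \<in> verts (amalgam_list Gs (Inl ` J))"
      proof cases
        case 1
        then show ?thesis by (auto simp: verts_amalgam_list len f_def mem_J)
      next
        case 2
        have "h x \<in> {..<c} \<times> {None} \<union> {c..<c + m} \<times> range Some" "fst (h x) < c + m"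
          using 2 him slot[of x] by auto
        then have "emb (snd (h x)) (a, \<one>\<^bsub>F2\<^esub>) \<in> verts (Gs ! fst (h x)) - Inl ` J"
          using 2 vGs[of "fst (h x)"] by (metis prod.collapse)
        with 2 \<open>fst (h x) < c + m\<close> show ?thesis
          by (simp add: verts_amalgam_list len f_def)
      qed
    next
      fix z assume "z \<in> verts (amalgam_list Gs (Inl ` J))"
      then consider u where "u \<in> J" "z = Inl (Inl u)"
        | i w where "i < c + m" "w \<in> verts (Gs ! i) - Inl ` J" "z = Inr (i, w)"
        by (auto simp: verts_amalgam_list len)
      then show "z \<in> f ` verts (reg_graph (RDirProd R F))"
      proof cases
        case 1
        then obtain a where "a \<in> carrier R - {\<zero>\<^bsub>R\<^esub>}" "z = f (a, \<zero>\<^bsub>F\<^esub>)"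
          by (auto simp: J_def f_def)
        then show ?thesis by (auto simp: reg_graph_def RDirProd_carrier zero_RDirProd)
      next
        case 2
        \<comment> \<open>By \<open>vGs\<close> a vertex in position \<open>i\<close> comes with a
          pair \<open>(i, t)\<close> in the range of \<open>h\<close>, and a preimage of this pair
          is the missing field coordinate.\<close>
        then obtain t a where ta: "a \<in> carrier R" "w = emb t (a, \<one>\<^bsub>F2\<^esub>)" "(i, t) \<in> h ` ?X"
          unfolding him using vGs by metis
        then obtain x where "x \<in> ?X" "h x = (i, t)" by (metis imageE)
        then have "z = f (a, x)" "x \<in> ?X" using 2 ta by (auto simp: f_def)
        then show ?thesis using ta by (auto simp: reg_graph_def RDirProd_carrier zero_RDirProd)
      qed
    qed
  qed

  \<comment> \<open>Preservation of adjacency\<close>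
  have edge_JJ: "{Inl u, Inl v} \<in> edges (Gs ! i) \<longleftrightarrow> {u, v} \<in> edges G"
    if "u \<in> J" "v \<in> J" "i < c + m" for u v i
    using that by (cases "i < c") (auto simp: Gs_lt Gs_ge edge_map_Inl_iff edge_AmB_iffs)
  \<comment> \<open>A vertex of \<open>J\<close> is joined to both lifts of a vertex in
    \<open>AmB\<close> or to neither, so every position shows the same adjacency as
    \<open>G\<close>.\<close>
  have edge_J: "{Inl u, emb (snd (h x)) (b, \<one>\<^bsub>F2\<^esub>)} \<in> edges (Gs ! fst (h x)) \<longleftrightarrow>
      {u, (b, \<one>\<^bsub>F2\<^esub>)} \<in> edges G" if "u \<in> J" "b \<in> carrier R" "x \<in> ?X" for u b x
    using slot[of x] that
    by (auto simp: Gs_lt Gs_ge edge_map_Inl_iff edge_AmB_iffs emb_def vGJ)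
  have cube: "a \<otimes>\<^bsub>R\<^esub> a \<otimes>\<^bsub>R\<^esub> a = a \<longleftrightarrow> a [^]\<^bsub>R\<^esub> (3::nat) = a" if "a \<in> carrier R" for a
    using that by (simp add: numeral_3_eq_3)
  \<comment> \<open>The edge between \<open>(a, \<zero>)\<close> and \<open>(b, \<one>)\<close> in
    \<open>G\<close> serves as a middle term: over \<open>F2\<close> and over \<open>F\<close> the
    criterion has the same right-hand side.\<close>
  have edge_0: "{(a, \<zero>\<^bsub>F\<^esub>), (b, y)} \<in> edges (reg_graph (RDirProd R F)) \<longleftrightarrow>
      {f (a, \<zero>\<^bsub>F\<^esub>), f (b, y)} \<in> edges (amalgam_list Gs (Inl ` J))"
    if "a \<in> carrier R - {\<zero>\<^bsub>R\<^esub>}" "b \<in> carrier R" "y \<in> ?X" for a b y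
  proof -
    have a: "a \<in> carrier R" "(a, \<zero>\<^bsub>F2\<^esub>) \<in> J" using that by (auto simp: mem_J)
    have "fst (h y) < c + m" using slot[of y] that by auto
    then have "{f (a, \<zero>\<^bsub>F\<^esub>), f (b, y)} \<in> edges (amalgam_list Gs (Inl ` J)) \<longleftrightarrow>
        {(a, \<zero>\<^bsub>F2\<^esub>), (b, \<one>\<^bsub>F2\<^esub>)} \<in> edges G"
      using that a edge_J[of "(a, \<zero>\<^bsub>F2\<^esub>)" b y] emb_J
      by (simp add: f_def edge_amalgam_list_iffs len)
    then show ?thesis
      using edge_product_field_iffs(2)[OF \<open>cring R\<close> field_F2 a(1) that(2) one]
        edge_product_field_iffs(2)[OF \<open>cring R\<close> \<open>field F\<close> a(1) that(2,3)]
      by (simp add: G_def)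
  qed
  have edge_1: "{(a, x), (b, y)} \<in> edges (reg_graph (RDirProd R F)) \<longleftrightarrow>
      {f (a, x), f (b, y)} \<in> edges (amalgam_list Gs (Inl ` J))"
    if ab: "a \<in> carrier R" "b \<in> carrier R" and xy: "x \<in> ?X" "y \<in> ?X" for a b x y
  proof -
    define adj where "adj \<longleftrightarrow> a \<otimes>\<^bsub>R\<^esub> b \<otimes>\<^bsub>R\<^esub> a = a \<or> b \<otimes>\<^bsub>R\<^esub> a \<otimes>\<^bsub>R\<^esub> b = b"
    have lhs: "{(a, x), (b, y)} \<in> edges (reg_graph (RDirProd R F)) \<longleftrightarrow>
        fst (h x) = fst (h y) \<and> (snd (h x) = None \<or> snd (h x) \<noteq> snd (h y)) \<and> (a, x) \<noteq> (b, y) \<and> adj"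
      using edge_product_field_iffs(3)[OF \<open>cring R\<close> \<open>field F\<close> ab xy] hs[OF xy]
      by (simp add: adj_def)
    \<comment> \<open>Over \<open>F2\<close> both field coordinates are \<open>\<one>\<close>, so
      the inverse condition is automatic, and distinctness must come from \<open>R\<close>.\<close>
    have edge_G: "{(a, \<one>\<^bsub>F2\<^esub>), (b, \<one>\<^bsub>F2\<^esub>)} \<in> edges G \<longleftrightarrow> a \<noteq> b \<and> adj"
      using edge_product_field_iffs(3)[OF \<open>cring R\<close> field_F2 ab one one]
      by (simp add: G_def adj_def)
    \<comment> \<open>For \<open>a = b\<close> the condition \<open>adj\<close> says that the cube
      of \<open>a\<close> is \<open>a\<close>. The edges given by \<open>A\<close> thus supply
      exactly the pairs that \<open>edge_G\<close> excludes.\<close>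
    have mem_A: "a = b \<and> (b, \<one>\<^bsub>F2\<^esub>) \<in> A \<longleftrightarrow> a = b \<and> adj"
      using ab cube[of b] by (auto simp: A_def adj_def)
    have h_eq: "h x = h y \<longleftrightarrow> x = y" using h xy by (auto simp: bij_betw_def inj_on_def)
    have rhs: "{f (a, x), f (b, y)} \<in> edges (amalgam_list Gs (Inl ` J)) \<longleftrightarrow>
        fst (h x) = fst (h y) \<and> fst (h x) < c + m \<and>
        {emb (snd (h x)) (a, \<one>\<^bsub>F2\<^esub>), emb (snd (h y)) (b, \<one>\<^bsub>F2\<^esub>)} \<in> edges (Gs ! fst (h x))"
      using xy emb_J by (simp add: f_def edge_amalgam_list_iffs len)
    show ?thesis
    proof (cases "fst (h x) = fst (h y)")
      case True
      from slot[OF xy(1)] show ?thesis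
      proof (elim disjE exE conjE)
        \<comment> \<open>At a fixed point, \<open>h x = h y\<close> and hence \<open>x = y\<close>,
          so distinctness of the vertices reduces to \<open>a \<noteq> b\<close>, as in
          \<open>G\<close>.\<close>
        fix i assume "i < c" "h x = (i, None)"
        moreover from this have "h y = (i, None)" using slot[OF xy(2)] True by auto
        ultimately show ?thesis
          unfolding lhs rhs using h_eq edge_G by (auto simp: Gs_lt emb_def edge_map_Inl_iff)
      next
        \<comment> \<open>For equal bits neither side has an edge. For different bits
          \<open>x \<noteq> y\<close>, so the vertices are distinct even if \<open>a = b\<close>;
          cover edges account for \<open>a \<noteq> b\<close> and the edges from \<open>A\<close>
          for \<open>a = b\<close>.\<close>
        fix i b' assume i: "c \<le> i" "i < c + m" "h x = (i, Some b')"
        moreover from this obtain b'' where "h y = (i, Some b'')" using slot[OF xy(2)] True by auto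
        ultimately show ?thesis
          unfolding lhs rhs using h_eq edge_G mem_A ab
          by (auto simp: Gs_ge emb_def edge_AmB_iffs vGJ)
      qed
    qed (simp add: lhs rhs)
  qed
  have "{u, v} \<in> edges (reg_graph (RDirProd R F)) \<longleftrightarrow>
      {f u, f v} \<in> edges (amalgam_list Gs (Inl ` J))"
    if uv: "u \<in> verts (reg_graph (RDirProd R F))" "v \<in> verts (reg_graph (RDirProd R F))" for u v
  proof -
    obtain a x b y where [simp]: "u = (a, x)" "v = (b, y)" by (metis surj_pair)
    have ab: "a \<in> carrier R" "b \<in> carrier R" and xy: "x \<in> carrier F" "y \<in> carrier F"
      and nz: "x = \<zero>\<^bsub>F\<^esub> \<Longrightarrow> a \<noteq> \<zero>\<^bsub>R\<^esub>" "y = \<zero>\<^bsub>F\<^esub> \<Longrightarrow> b \<noteq> \<zero>\<^bsub>R\<^esub>"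
      using uv by (auto simp: reg_graph_def RDirProd_carrier zero_RDirProd)
    consider "x = \<zero>\<^bsub>F\<^esub>" "y = \<zero>\<^bsub>F\<^esub>" | "x = \<zero>\<^bsub>F\<^esub>" "y \<in> ?X" | "x \<in> ?X" "y = \<zero>\<^bsub>F\<^esub>" | "x \<in> ?X" "y \<in> ?X"
      using xy by blast
    then show ?thesis
    proof cases
      case 1
      then have J: "(a, \<zero>\<^bsub>F2\<^esub>) \<in> J" "(b, \<zero>\<^bsub>F2\<^esub>) \<in> J" using ab nz by (auto simp: mem_J)
      \<comment> \<open>All positions agree on \<open>J\<close>; \<open>c > 0\<close> provides one
        to witness the edge.\<close>
      then have "{f u, f v} \<in> edges (amalgam_list Gs (Inl ` J)) \<longleftrightarrow>
          {(a, \<zero>\<^bsub>F2\<^esub>), (b, \<zero>\<^bsub>F2\<^esub>)} \<in> edges G"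
        using 1 edge_JJ[OF J] \<open>c > 0\<close> by (auto simp: f_def edge_amalgam_list_iffs len)
      then show ?thesis
        using 1 edge_product_field_iffs(1)[OF \<open>cring R\<close> field_F2 ab]
          edge_product_field_iffs(1)[OF \<open>cring R\<close> \<open>field F\<close> ab]
        by (simp add: G_def)
    next
      case 2
      then show ?thesis using edge_0[of a b y] ab nz by simp
    next
      case 3
      then show ?thesis using edge_0[of b a x] ab nz by (simp add: insert_commute)
    next
      case 4
      then show ?thesis using edge_1 ab by simp
    qed
  qed
  with bij show ?thesis
    unfolding graph_iso_def Gs_def[symmetric] by blast
qed

theorem theorem12:
  fixes R :: "('a, 'm) ring_scheme" and F :: "('b, 'l) ring_scheme"
    and G :: "('a \<times> int) sgraph" and A J :: "('a \<times> int) set"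
    and p k n :: nat
  assumes "cring R" and "finite (carrier R)" and "von_neumann_regular R"
    and G: "G = reg_graph (RDirProd R F2)"
    and A: "A = {(a, \<one>\<^bsub>F2\<^esub>) | a. a \<in> carrier R \<and> a [^]\<^bsub>R\<^esub> (3::nat) = a}"
    and J: "J = {(u, \<zero>\<^bsub>F2\<^esub>) | u. u \<in> carrier R - {\<zero>\<^bsub>R\<^esub>}}"
    and "field F" and "prime p" and "k > 0" and "n = p ^ k" and "card (carrier F) = n"
  shows "graph_iso (reg_graph (RDirProd R F))
    (if p = 2
     then amalgam_list
            (map_graph Inl G # replicate ((n - 2) div 2) (AmB A G J)) (Inl ` J)
     else amalgam_list
            (map_graph Inl G # map_graph Inl G # replicate ((n - 3) div 2) (AmB A G J)) (Inl ` J))"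
proof -
  interpret F: field F by fact
  \<comment> \<open>An infinite carrier would have \<open>card\<close> equal to 0, whereas a power
    of a prime is positive.\<close>
  have fin: "finite (carrier F)"
    using assms(8,10,11) by (intro card_ge_0_finite) (simp add: prime_gt_0_nat)
  have ord: "order F = n" using assms(11) by (simp add: order_def)
  \<comment> \<open>As \<open>k > 0\<close>, 2 divides \<open>p ^ k\<close> only if it divides the
    prime \<open>p\<close>.\<close>
  have ev: "even n \<longleftrightarrow> p = 2"
    using assms(8-10) by (metis even_power primes_dvd_imp_eq two_is_prime_nat dvd_refl)
  define c where "c = (if p = 2 then 1 else 2 :: nat)"
  define m where "m = (n - 1 - c) div 2"
  obtain h :: "'b \<Rightarrow> nat \<times> bit option" where
    "bij_betw h (carrier F - {\<zero>\<^bsub>F\<^esub>}) ({..<c} \<times> {None} \<union> {c..<c + m} \<times> range Some)"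
    "\<And>x y. x \<in> carrier F - {\<zero>\<^bsub>F\<^esub>} \<Longrightarrow> y \<in> carrier F - {\<zero>\<^bsub>F\<^esub>} \<Longrightarrow>
      x \<otimes>\<^bsub>F\<^esub> y = \<one>\<^bsub>F\<^esub> \<longleftrightarrow> fst (h x) = fst (h y) \<and> (snd (h x) = None \<or> snd (h x) \<noteq> snd (h y))"
    using F.units_enum[OF fin] unfolding ord ev c_def m_def by blast
  then have iso: "graph_iso (reg_graph (RDirProd R F))
      (amalgam_list (replicate c (map_graph Inl G) @ replicate m (AmB A G J)) (Inl ` J))"
    unfolding G A J by (intro graph_iso_amalgam_list) (use assms in \<open>auto simp: c_def\<close>)
  \<comment> \<open>Apart from zero and the \<open>c\<close> self-inverse units, the elements of
    \<open>F\<close> pair up.\<close>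
  have "m = (if p = 2 then (n - 2) div 2 else (n - 3) div 2)"
    unfolding m_def c_def by (cases "p = 2") (simp_all)
  with iso show ?thesis
    by (simp add: c_def numeral_2_eq_2 split: if_splits)
qed

end
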